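(* Let $d\ge 1$ and let $\beta \equiv \{\beta_{\mathbf{i}}\}_{\mathbf{i}\in\mathbb{Z}_+^d}$ be a multisequence of real numbers. Let $M(\beta)$ be the moment matrix associated with $\beta$ and, for each $n$, let $M(n)$ be the moment matrix associated with $\{\beta_{\mathbf{i}}\}_{|\mathbf{i}|\le 2n,\ \mathbf{i}\in\mathbb{Z}_+^d}$. The following are equivalent: (1) $M(\beta)$ is a finite-rank positive semidefinite matrix. (2) $\beta$ is recursively generated, with associated minimal characteristic polynomials $(p_1,\ldots,p_d)$, and $M(\tau)\ge 0$, where $\tau=\sum_{i=1}^d(\deg p_i-1)$. (3) $\beta$ has a unique representing measure, which is $\operatorname{rank} M(\beta)$-atomic (that is, $\operatorname{rank}M(\beta)<\infty$, and the measure is supported on exactly $\operatorname{rank} M(\beta)$ points).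
   Context: $\mathbb{Z}_+$ denotes the nonnegative integers. For $\mathbf{i}=(i_1,\ldots,i_d)\in\mathbb{Z}_+^d$ put $|\mathbf{i}|=i_1+\cdots+i_d$ and $\mathbf{x}^{\mathbf{i}}=x_1^{i_1}\cdots x_d^{i_d}$. $\epsilon_l\in\mathbb{Z}_+^d$ is the tuple with $1$ in position $l$ and $0$ elsewhere. Moment matrices: $M(\beta)=(\beta_{\mathbf{i}+\mathbf{j}})_{\mathbf{i},\mathbf{j}\in\mathbb{Z}_+^d}$ and $M(n)=(\beta_{\mathbf{i}+\mathbf{j}})_{|\mathbf{i}|,|\mathbf{j}|\le n}$. $M(\beta)\ge 0$ (positive semidefinite) means $\sum_{\mathbf{i},\mathbf{j}}a_{\mathbf{i}}a_{\mathbf{j}}\beta_{\mathbf{i}+\mathbf{j}}\ge 0$ for every finitely supported real family $(a_{\mathbf{i}})$; the rank is the dimension of the span of the columns. Representing measure for $\beta$: a positive Borel measure $\mu$ on $\mathbb{R}^d$ with $\beta_{\mathbf{i}}=\int\mathbf{x}^{\mathbf{i}}\,d\mu$ for all $\mathbf{i}\in\mathbb{Z}_+^d$. A measure is $r$-atomic if it is a sum of positive point masses at exactly $r$ distinct points. Recursively generated multisequences: a $d$-tuple $(p_1,\ldots,p_d)$ of univariate real polynomials $p_l(x)=\sum_k p_{l,k}x^k$ is called characteristic for $\beta$ if $\sum_k p_{l,k}\,\beta_{k\epsilon_l+\mathbf{i}}=0$ for all $\mathbf{i}\in\mathbb{Z}_+^d$ and all $1\le l\le d$. Thus, for monic $p_l(x)=x^{m_l+1}-a_0^{(l)}x^{m_l}-\cdots-a_{m_l}^{(l)}$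 this says $\beta_{(m_l+1)\epsilon_l+\mathbf{i}}=a_0^{(l)}\beta_{m_l\epsilon_l+\mathbf{i}}+\cdots+a_{m_l}^{(l)}\beta_{\mathbf{i}}$. $\beta$ is recursively generated if it has a characteristic tuple consisting of monic polynomials. In that case the minimal characteristic polynomials of $\beta$ are the unique tuple $(p_1,\ldots,p_d)$ of monic characteristic polynomials such that each $p_l$ has minimal degree; for every characteristic tuple $(Q_1,\ldots,Q_d)$, $p_l$ divides $Q_l$ for all $l$. (If $\beta=0$, then $p_l=1$ for all $l$, and $M(\tau)$ with $\tau<0$ is the empty matrix, regarded as positive semidefinite.) *)

theory Defs
  imports
    "HOL-Analysis.Analysis"
    "HOL-Computational_Algebra.Polynomial"
    "HOL-Library.Function_Algebras"
begin

text \<open>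
  Multi-indices in \<open>d\<close> variables are elements of \<^typ>\<open>nat ^ 'd\<close> and points of the \<open>d\<close>-dimensional
  Euclidean space are elements of \<^typ>\<open>real ^ 'd\<close>, where \<open>d = CARD('d) \<ge> 1\<close>. A multisequence is a
  function on multi-indices; the multi-index \<open>k \<epsilon>\<^sub>l\<close> is \<^term>\<open>axis l (k::nat)\<close>.
\<close>

definition total_degree :: "nat ^ 'd \<Rightarrow> nat"
  where "total_degree i = (\<Sum>l\<in>UNIV. i $ l)"

definition monomial_at :: "nat ^ 'd \<Rightarrow> real ^ 'd \<Rightarrow> real"
  where "monomial_at i x = (\<Prod>l\<in>UNIV. (x $ l) ^ (i $ l))"

text \<open>Functions form a real vector space pointwise; this makes \<^const>\<open>span\<close> and \<^const>\<open>dim\<close>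
  available for the columns of a matrix with an arbitrary index type.\<close>

instantiation "fun" :: (type, real_vector) real_vector
begin

definition scaleR_fun :: "real \<Rightarrow> ('a \<Rightarrow> 'b) \<Rightarrow> 'a \<Rightarrow> 'b"
  where "scaleR_fun c f = (\<lambda>x. c *\<^sub>R f x)"

instance
  by standard (auto simp: scaleR_fun_def fun_eq_iff scaleR_add_right scaleR_add_left)

end

definition columns_of :: "('i \<Rightarrow> 'i \<Rightarrow> real) \<Rightarrow> ('i \<Rightarrow> real) set"
  where "columns_of A = range (\<lambda>j i. A i j)"

definition finite_rank :: "('i \<Rightarrow> 'i \<Rightarrow> real) \<Rightarrow> bool"
  where "finite_rank A \<longleftrightarrow> (\<exists>B. finite B \<and> span B = span (columns_of A))"

text \<open>\<^const>\<open>dim\<close> is the cardinality of a basis, hence \<open>0\<close> when the column space is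
  infinite-dimensional: this value is meaningful only together with \<^const>\<open>finite_rank\<close>.\<close>

definition matrix_rank :: "('i \<Rightarrow> 'i \<Rightarrow> real) \<Rightarrow> nat"
  where "matrix_rank A = dim (columns_of A)"

text \<open>Symmetry is not part of \<open>psd_on\<close>: it is applied to moment matrices only, which are symmetric.\<close>

definition psd_on :: "'i set \<Rightarrow> ('i \<Rightarrow> 'i \<Rightarrow> real) \<Rightarrow> bool"
  where "psd_on I A \<longleftrightarrow>
    (\<forall>a :: 'i \<Rightarrow> real. finite {i. a i \<noteq> 0} \<and> {i. a i \<noteq> 0} \<subseteq> I \<longrightarrow>
      0 \<le> (\<Sum>i\<in>{i. a i \<noteq> 0}. \<Sum>j\<in>{j. a j \<noteq> 0}. a i * a j * A i j))"

definition moment_matrix :: "(nat ^ 'd \<Rightarrow> real) \<Rightarrow> nat ^ 'd \<Rightarrow> nat ^ 'd \<Rightarrow> real"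
  where "moment_matrix \<beta> i j = \<beta> (i + j)"

definition moment_psd :: "(nat ^ 'd \<Rightarrow> real) \<Rightarrow> bool"
  where "moment_psd \<beta> \<longleftrightarrow> psd_on UNIV (moment_matrix \<beta>)"

text \<open>The order \<open>n\<close> is an integer: for \<open>n < 0\<close> the index set is empty, so \<open>M(n)\<close> is the empty
  matrix and is positive semidefinite.\<close>

definition truncated_moment_psd :: "(nat ^ 'd \<Rightarrow> real) \<Rightarrow> int \<Rightarrow> bool"
  where "truncated_moment_psd \<beta> n \<longleftrightarrow>
    psd_on {i. int (total_degree i) \<le> n} (moment_matrix \<beta>)"

definition representing_measure :: "(nat ^ 'd \<Rightarrow> real) \<Rightarrow> (real ^ 'd) measure \<Rightarrow> bool"
  where "representing_measure \<beta> \<mu> \<longleftrightarrow>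
    sets \<mu> = sets borel \<and>
    (\<forall>i. integrable \<mu> (monomial_at i) \<and> \<beta> i = (\<integral>x. monomial_at i x \<partial>\<mu>))"

definition atomic_measure :: "nat \<Rightarrow> (real ^ 'd) measure \<Rightarrow> bool"
  where "atomic_measure r \<mu> \<longleftrightarrow>
    sets \<mu> = sets borel \<and>
    (\<exists>S w. finite S \<and> card S = r \<and> (\<forall>x\<in>S. (0::real) < w x) \<and>
      (\<forall>A\<in>sets borel. emeasure \<mu> A = (\<Sum>x\<in>S. ennreal (w x) * indicator A x)))"

definition characteristic :: "(nat ^ 'd \<Rightarrow> real) \<Rightarrow> ('d \<Rightarrow> real poly) \<Rightarrow> bool"
  where "characteristic \<beta> p \<longleftrightarrow>
    (\<forall>l i. (\<Sum>k\<le>degree (p l). coeff (p l) k * \<beta> (axis l k + i)) = 0)"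

definition monic_tuple :: "('d \<Rightarrow> real poly) \<Rightarrow> bool"
  where "monic_tuple p \<longleftrightarrow> (\<forall>l. lead_coeff (p l) = 1)"

definition recursively_generated :: "(nat ^ 'd \<Rightarrow> real) \<Rightarrow> bool"
  where "recursively_generated \<beta> \<longleftrightarrow> (\<exists>p. characteristic \<beta> p \<and> monic_tuple p)"

definition minimal_characteristic :: "(nat ^ 'd \<Rightarrow> real) \<Rightarrow> ('d \<Rightarrow> real poly) \<Rightarrow> bool"
  where "minimal_characteristic \<beta> p \<longleftrightarrow>
    characteristic \<beta> p \<and> monic_tuple p \<and>
    (\<forall>q. characteristic \<beta> q \<and> monic_tuple q \<longrightarrow> (\<forall>l. degree (p l) \<le> degree (q l)))"

definition char_order :: "('d::finite \<Rightarrow> real poly) \<Rightarrow> int"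
  where "char_order p = (\<Sum>l\<in>UNIV. (int (degree (p l)) - 1))"

lemma char_sum_bound:
  fixes p :: "real poly"
  assumes "degree p \<le> n"
  shows "(\<Sum>k\<le>degree p. coeff p k * f k) = (\<Sum>k\<le>n. coeff p k * f k)"
  using assms by (intro sum.mono_neutral_left) (auto simp: coeff_eq_0)

lemma ex1_minimal_characteristic:
  fixes \<beta> :: "nat ^ 'd \<Rightarrow> real"
  assumes "recursively_generated \<beta>"
  shows "\<exists>!p. minimal_characteristic \<beta> p"
proof -
  define P where "P = (\<lambda>p. characteristic \<beta> p \<and> monic_tuple p)"
  obtain p0 where p0: "P p0"
    using assms by (auto simp: recursively_generated_def P_def)
  have "\<exists>q. P q \<and> (\<forall>r. P r \<longrightarrow> degree (q l) \<le> degree (r l))" for l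
    using ex_has_least_nat[of P p0 "\<lambda>p. degree (p l)"] p0 by blast
  then obtain q where q: "\<And>l. P (q l)" "\<And>l r. P r \<Longrightarrow> degree (q l l) \<le> degree (r l)"
    by metis
  define p where "p = (\<lambda>l. q l l)"
  have "minimal_characteristic \<beta> p"
    using q unfolding minimal_characteristic_def P_def p_def characteristic_def monic_tuple_def
    by blast
  moreover have "p = p'" if p: "minimal_characteristic \<beta> p" and p': "minimal_characteristic \<beta> p'"
    for p p'
  proof (rule ext, rule ccontr)
    fix l assume neq: "p l \<noteq> p' l"
    define u where "u = p l - p' l"
    define c where "c = lead_coeff u"
    define v where "v = smult (inverse c) u"
    have deg: "degree (p l) = degree (p' l)"
      using p p' by (auto simp: minimal_characteristic_def intro!: antisym)
    have monic: "lead_coeff (p l) = 1" "lead_coeff (p' l) = 1"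
      using p p' by (auto simp: minimal_characteristic_def monic_tuple_def)
    have u0: "u \<noteq> 0"
      using neq by (simp add: u_def)
    then have c0: "c \<noteq> 0"
      unfolding c_def by (simp only: leading_coeff_0_iff not_False_eq_True)
    have "degree u \<le> degree (p l)"
      unfolding u_def using deg by (metis degree_diff_le order_refl)
    moreover have "coeff u (degree (p l)) = 0"
      using monic deg by (simp add: u_def)
    ultimately have less: "degree u < degree (p l)"
      using u0 leading_coeff_0_iff[of u] by (metis order_le_imp_less_or_eq)
    have ann: "(\<Sum>k\<le>degree v. coeff v k * \<beta> (axis l k + i)) = 0" for i
    proof -
      have "(\<Sum>k\<le>degree v. coeff v k * \<beta> (axis l k + i))
          = (\<Sum>k\<le>degree (p l). coeff v k * \<beta> (axis l k + i))"
        using less by (intro char_sum_bound) (simp add: v_def)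
      also have "\<dots> = inverse c * ((\<Sum>k\<le>degree (p l). coeff (p l) k * \<beta> (axis l k + i))
          - (\<Sum>k\<le>degree (p' l). coeff (p' l) k * \<beta> (axis l k + i)))"
        using deg
        by (simp add: v_def u_def sum_subtractf[symmetric] sum_distrib_left algebra_simps)
      also have "\<dots> = 0"
        using p p' by (simp add: minimal_characteristic_def characteristic_def)
      finally show ?thesis .
    qed
    have "lead_coeff v = 1"
      using c0 by (simp add: v_def c_def)
    then have "characteristic \<beta> (p(l := v))" "monic_tuple (p(l := v))"
      using p ann by (simp_all add: minimal_characteristic_def characteristic_def monic_tuple_def)
    then have "degree (p l) \<le> degree ((p(l := v)) l)"
      using p unfolding minimal_characteristic_def by blast
    with less show False
      using c0 by (simp add: v_def)
  qed
  ultimately show ?thesis by blast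
qed

end

theory Submission
  imports Defs "HOL-Computational_Algebra.Fundamental_Theorem_Algebra"
begin

text \<open>
  Write \<open>L\<close> for the linear functional that sends the monomial \<open>x\<^sup>i\<close> to \<open>\<beta> i\<close>, so that the quadratic form of
  the moment matrix is \<open>f \<mapsto> L (f\<^sup>2)\<close>. Multiplication by a coordinate acts on multisequences as a shift
  \<open>S\<^sub>l\<close>, and the polynomials \<open>q\<close> with \<open>q (S\<^sub>l) \<beta> = 0\<close> are the characteristic polynomials of \<open>\<beta>\<close> in
  direction \<open>l\<close>. The shifts commute, which replaces a formal ring of multivariate polynomials.

  From (1) to (3), and from (1) to (2). Finite rank makes the columns with indices \<open>k \<epsilon>\<^sub>l\<close> linearly
  dependent, so every direction has a monic characteristic polynomial; with positivity restricted to
  the truncation this is (2). Positivity makes \<open>f (S\<^sub>l) \<beta>\<close> vanish as soon as \<open>L (f\<^sup>2) = 0\<close>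
  (\<open>shift_by_zero_if_square_zero\<close>), hence a characteristic polynomial can be lowered in degree until all
  its roots are real and simple (\<open>annihilator_with_simple_real_roots\<close>). Then the commuting shifts are
  simultaneously diagonalisable on \<open>\<beta>\<close>. A joint eigenvector with eigenvalues \<open>g\<close> is a multiple of
  \<open>i \<mapsto> g\<^sup>i\<close>, so \<open>\<beta> i = (\<Sum>g\<in>S. w g * g\<^sup>i)\<close> for a finite set \<open>S\<close> of points and nonzero weights
  (\<open>in_span_monomials_on_grid\<close>).

  Polynomials that are \<open>1\<close> at one point of \<open>S\<close> and \<open>0\<close> at the others now settle the rest. They show
  that the weights are positive (\<open>moment_psd_weight_nonneg\<close>), that the rank is the number of points
  (\<open>matrix_rank_eq_card_points\<close>) and that a representing measure has mass \<open>w g\<close> at \<open>g\<close>. A nonnegative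
  polynomial whose zero set is \<open>S\<close> has integral \<open>0\<close>, so no representing measure has mass outside \<open>S\<close>
  (\<open>emeasure_representing_measure\<close>).

  From (2) to (1). The relations \<open>p\<^sub>l (S\<^sub>l) \<beta> = 0\<close> express every column through the columns with
  index in the box \<open>j\<^sub>l < deg p\<^sub>l\<close>. The box is finite and lies in degrees at most \<open>\<tau>\<close>, so
  positivity on the box, which is part of \<open>M(\<tau>) \<ge> 0\<close>, extends to the whole matrix
  (\<open>finite_rank_psd_if_truncated_psd\<close>). From (3) to (1), \<open>L (f\<^sup>2)\<close> is the integral of a square.
\<close>

section \<open>Polynomials in a shift operator\<close>

definition shift_by :: "'d \<Rightarrow> real poly \<Rightarrow> (nat ^ 'd \<Rightarrow> real) \<Rightarrow> nat ^ 'd \<Rightarrow> real"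
  where "shift_by l q \<beta> = (\<lambda>i. \<Sum>k\<le>degree q. coeff q k * \<beta> (axis l k + i))"

lemma characteristic_iff_shift_by: "characteristic \<beta> p \<longleftrightarrow> (\<forall>l. shift_by l (p l) \<beta> = 0)"
  by (auto simp: characteristic_def shift_by_def fun_eq_iff)

lemma axis_add: "axis l a + axis l b = axis l (a + b :: nat)"
  by (simp add: vec_eq_iff axis_def)

lemma axis_zero: "axis l (0::nat) = 0"
  by (simp add: vec_eq_iff axis_def)

lemma shift_by_eq_sum:
  assumes "degree q \<le> n"
  shows "shift_by l q \<beta> i = (\<Sum>k\<le>n. coeff q k * \<beta> (axis l k + i))"
  unfolding shift_by_def by (rule char_sum_bound[OF assms])

lemma shift_by_0_left [simp]: "shift_by l 0 \<beta> = 0"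
  by (simp add: shift_by_def fun_eq_iff)

lemma shift_by_0_right [simp]: "shift_by l q 0 = 0"
  by (simp add: shift_by_def fun_eq_iff)

lemma shift_by_const: "shift_by l [:c:] \<beta> = c *\<^sub>R \<beta>"
  by (simp add: shift_by_def fun_eq_iff axis_zero scaleR_fun_def)

lemma shift_by_add: "shift_by l (p + q) \<beta> = shift_by l p \<beta> + shift_by l q \<beta>"
proof
  fix i
  let ?n = "max (degree p) (degree q)"
  show "shift_by l (p + q) \<beta> i = (shift_by l p \<beta> + shift_by l q \<beta>) i"
    by (simp add: shift_by_eq_sum[of p ?n] shift_by_eq_sum[of q ?n]
        shift_by_eq_sum[of "p + q" ?n] degree_add_le sum.distrib algebra_simps)
qed

lemma shift_by_smult: "shift_by l (smult c q) \<beta> = c *\<^sub>R shift_by l q \<beta>"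
  by (rule ext) (simp add: shift_by_eq_sum[of "smult c q" "degree q"] shift_by_def scaleR_fun_def
      sum_distrib_left mult.assoc)

text \<open>
  The recursion of Horner's scheme; it turns identities between polynomials in a shift into inductions
  over the coefficients.
\<close>

lemma shift_by_pCons: "shift_by l (pCons a q) \<beta> i = a * \<beta> i + shift_by l q \<beta> (axis l 1 + i)"
proof -
  have "shift_by l (pCons a q) \<beta> i
      = (\<Sum>k\<le>Suc (degree q). coeff (pCons a q) k * \<beta> (axis l k + i))"
    by (rule shift_by_eq_sum) (simp add: degree_pCons_le)
  also have "\<dots> = a * \<beta> i + (\<Sum>k\<le>degree q. coeff q k * \<beta> (axis l (k + 1) + i))"
    by (subst sum.atMost_Suc_shift) (simp add: axis_zero)
  also have "(\<Sum>k\<le>degree q. coeff q k * \<beta> (axis l (k + 1) + i)) = shift_by l q \<beta> (axis l 1 + i)"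
    by (simp only: shift_by_def axis_add[symmetric] add.assoc)
  finally show ?thesis .
qed

lemma shift_by_mult: "shift_by l (p * q) \<beta> = shift_by l p (shift_by l q \<beta>)"
proof (induction p)
  case (pCons a p)
  show ?case
  proof
    fix i
    have "shift_by l (pCons a p * q) \<beta> i = a * shift_by l q \<beta> i + shift_by l (p * q) \<beta> (axis l 1 + i)"
      by (simp add: shift_by_add shift_by_smult shift_by_pCons scaleR_fun_def)
    also have "\<dots> = shift_by l (pCons a p) (shift_by l q \<beta>) i"
      by (simp add: pCons.IH shift_by_pCons)
    finally show "shift_by l (pCons a p * q) \<beta> i = shift_by l (pCons a p) (shift_by l q \<beta>) i" .
  qed
qed simp

lemma shift_by_commute: "shift_by l p (shift_by m q \<beta>) = shift_by m q (shift_by l p \<beta>)"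
proof
  fix i
  have "shift_by l p (shift_by m q \<beta>) i
      = (\<Sum>k\<le>degree p. \<Sum>n\<le>degree q. coeff p k * coeff q n * \<beta> (axis l k + (axis m n + i)))"
    by (simp add: shift_by_def sum_distrib_left mult.assoc add.left_commute)
  also have "\<dots> = (\<Sum>n\<le>degree q. \<Sum>k\<le>degree p. coeff p k * coeff q n * \<beta> (axis l k + (axis m n + i)))"
    by (rule sum.swap)
  also have "\<dots> = shift_by m q (shift_by l p \<beta>) i"
    by (simp add: shift_by_def sum_distrib_left ac_simps)
  finally show "shift_by l p (shift_by m q \<beta>) i = shift_by m q (shift_by l p \<beta>) i" .
qed

section \<open>Positive semidefinite moment matrices\<close>

lemma psd_on_sum_nonneg:
  assumes psd: "psd_on I A" and "finite F" "F \<subseteq> I"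
  shows "0 \<le> (\<Sum>i\<in>F. \<Sum>j\<in>F. a i * a j * A i j)"
proof -
  define b where "b = (\<lambda>i. if i \<in> F then a i else 0)"
  define T where "T = {i. b i \<noteq> 0}"
  have T: "T \<subseteq> F" by (auto simp: T_def b_def)
  then have "0 \<le> (\<Sum>i\<in>T. \<Sum>j\<in>T. b i * b j * A i j)"
    using psd assms(2,3) unfolding psd_on_def T_def by (meson finite_subset order_trans)
  also have "\<dots> = (\<Sum>i\<in>F. \<Sum>j\<in>F. b i * b j * A i j)"
  proof -
    have "(\<Sum>j\<in>T. b i * b j * A i j) = (\<Sum>j\<in>F. b i * b j * A i j)" for i
      using T assms(2) by (intro sum.mono_neutral_left) (auto simp: T_def)
    then show ?thesis
      using T assms(2) by (simp, intro sum.mono_neutral_left) (auto simp: T_def)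
  qed
  also have "\<dots> = (\<Sum>i\<in>F. \<Sum>j\<in>F. a i * a j * A i j)"
    by (simp add: b_def)
  finally show ?thesis .
qed

text \<open>
  Positivity for finite families of indices with possible repetitions. Repeated indices are merged by
  adding their coefficients. The border \<open>i\<close> in the lemma below may coincide with one of the
  indices \<open>k \<epsilon>\<^sub>l\<close>, which is why repetitions have to be allowed.
\<close>

lemma moment_psd_family:
  assumes psd: "moment_psd \<beta>" and fin: "finite I"
  shows "0 \<le> (\<Sum>s\<in>I. \<Sum>t\<in>I. a s * a t * \<beta> (c s + c t))"
proof -
  define b where "b = (\<lambda>i. \<Sum>s\<in>{s\<in>I. c s = i}. a s)"
  have group: "(\<Sum>s\<in>I. a s * h (c s)) = (\<Sum>i\<in>c ` I. b i * h i)" for h :: "_ \<Rightarrow> real"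
  proof -
    have "(\<Sum>s\<in>I. a s * h (c s)) = (\<Sum>i\<in>c ` I. \<Sum>s\<in>{s\<in>I. c s = i}. a s * h (c s))"
      by (rule sum.image_gen[OF fin])
    also have "\<dots> = (\<Sum>i\<in>c ` I. b i * h i)"
      by (auto simp: b_def sum_distrib_right intro!: sum.cong)
    finally show ?thesis .
  qed
  have "0 \<le> (\<Sum>i\<in>c ` I. \<Sum>j\<in>c ` I. b i * b j * \<beta> (i + j))"
    using psd_on_sum_nonneg[of UNIV "moment_matrix \<beta>" "c ` I" b] psd fin
    by (simp add: moment_psd_def moment_matrix_def)
  also have "\<dots> = (\<Sum>i\<in>c ` I. b i * (\<Sum>j\<in>c ` I. b j * \<beta> (i + j)))"
    by (simp add: sum_distrib_left mult.assoc)
  also have "\<dots> = (\<Sum>s\<in>I. a s * (\<Sum>t\<in>I. a t * \<beta> (c s + c t)))"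
    by (simp only: group[symmetric])
  also have "\<dots> = (\<Sum>s\<in>I. \<Sum>t\<in>I. a s * a t * \<beta> (c s + c t))"
    by (simp add: sum_distrib_left mult.assoc)
  finally show ?thesis .
qed

text \<open>
  This is \<open>0 \<le> L ((f (x\<^sub>l) + t x\<^sup>i)\<^sup>2)\<close> expanded in powers of \<open>t\<close>.
\<close>

lemma moment_psd_shift_square_bordered:
  assumes "moment_psd \<beta>"
  shows "0 \<le> shift_by l (f * f) \<beta> 0 + 2 * t * shift_by l f \<beta> i + t\<^sup>2 * \<beta> (i + i)"
proof -
  define n where "n = degree f"
  define a where "a = (\<lambda>k. if k \<le> n then coeff f k else t)"
  define c where "c = (\<lambda>k. if k \<le> n then axis l k else i)"
  have sq: "shift_by l (f * f) \<beta> 0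
      = (\<Sum>k\<le>n. \<Sum>m\<le>n. coeff f k * coeff f m * \<beta> (axis l k + axis l m))"
    unfolding shift_by_mult
    by (simp add: shift_by_def n_def sum_distrib_left mult.assoc add.commute)
  have "0 \<le> (\<Sum>k\<le>Suc n. \<Sum>m\<le>Suc n. a k * a m * \<beta> (c k + c m))"
    by (rule moment_psd_family[OF assms]) simp
  also have "\<dots> = (\<Sum>k\<le>n. (\<Sum>m\<le>n. coeff f k * coeff f m * \<beta> (axis l k + axis l m))
        + coeff f k * t * \<beta> (axis l k + i))
      + ((\<Sum>m\<le>n. t * coeff f m * \<beta> (i + axis l m)) + t * t * \<beta> (i + i))"
    by (simp add: a_def c_def)
  also have "\<dots> = shift_by l (f * f) \<beta> 0 + 2 * t * shift_by l f \<beta> i + t\<^sup>2 * \<beta> (i + i)"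
    unfolding sq
    by (simp add: shift_by_def n_def[symmetric] sum.distrib sum_distrib_left power2_eq_square
        ac_simps)
  finally show ?thesis .
qed

lemma linear_coeff_zero_if_quadratic_nonneg:
  fixes b c :: real
  assumes "\<And>t. 0 \<le> 2 * t * b + t\<^sup>2 * c"
  shows "b = 0"
proof (rule ccontr)
  assume b: "b \<noteq> 0"
  \<comment> \<open>At \<open>t = - s b\<close> the linear term beats the quadratic one because \<open>s c \<le> 1\<close>.\<close>
  define s where "s = 1 / (\<bar>c\<bar> + 1)"
  have s: "0 < s" "s * c \<le> 1"
    by (auto simp: s_def field_simps)
  have "0 \<le> s * b\<^sup>2 * (s * c - 2)"
    using assms[of "- s * b"] by (simp add: power2_eq_square algebra_simps)
  moreover have "s * b\<^sup>2 * (s * c - 2) < 0"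
    using s b by (intro mult_pos_neg) auto
  ultimately show False by simp
qed

text \<open>
  The Cauchy--Schwarz inequality in the degenerate case: if \<open>L (f\<^sup>2) = 0\<close>, then \<open>L (f x\<^sup>i) = 0\<close> for
  all \<open>i\<close>, which says \<open>f (S\<^sub>l) \<beta> = 0\<close>.
\<close>

lemma shift_by_zero_if_square_zero:
  assumes "moment_psd \<beta>" and "shift_by l (f * f) \<beta> 0 = 0"
  shows "shift_by l f \<beta> = 0"
proof
  fix i
  show "shift_by l f \<beta> i = 0 i"
    using linear_coeff_zero_if_quadratic_nonneg[of "shift_by l f \<beta> i" "\<beta> (i + i)"]
      moment_psd_shift_square_bordered[OF assms(1), of l f _ i] assms(2) by simp
qed

lemma shift_by_square_nonneg:
  assumes "moment_psd \<beta>"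
  shows "0 \<le> shift_by l (f * f) \<beta> 0"
  using moment_psd_shift_square_bordered[OF assms, of l f 0 0] by simp

section \<open>Annihilating polynomials with simple real roots\<close>

lemma poly_map_of_real_of_real: "poly (map_poly of_real p) (of_real x :: complex) = of_real (poly p x)"
  by (induction p) (auto simp: map_poly_pCons)

lemma poly_map_of_real_add:
  "poly (map_poly of_real (p + q)) (z::complex) = poly (map_poly of_real p) z + poly (map_poly of_real q) z"
proof -
  have "map_poly (of_real :: real \<Rightarrow> complex) (p + q) = map_poly of_real p + map_poly of_real q"
    by (rule poly_eqI) (simp add: coeff_map_poly)
  then show ?thesis by simp
qed

lemma poly_map_of_real_mult:
  "poly (map_poly of_real (p * q)) (z::complex) = poly (map_poly of_real p) z * poly (map_poly of_real q) z"
proof (induction p)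
  case (pCons a p)
  then show ?case
    by (simp add: poly_map_of_real_add map_poly_pCons map_poly_smult algebra_simps)
qed simp

text \<open>
  The two ways in which a real polynomial can fail to have simple real roots only are exactly those
  that positivity excludes for a characteristic polynomial of least degree.
\<close>

lemma real_poly_cases:
  fixes q :: "real poly"
  assumes "q \<noteq> 0"
  obtains (simple_real_roots) c R where "c \<noteq> 0" "finite R" "q = smult c (\<Prod>a\<in>R. [:-a, 1:])"
  | (double_root) a r where "q = [:-a, 1:] * [:-a, 1:] * r"
  | (quadratic_factor) a b r where "b \<noteq> 0" "q = ([:-a, 1:] * [:-a, 1:] + [:b:] * [:b:]) * r"
proof -
  define R where "R = {x. poly q x = 0}"
  have finR: "finite R"
    using assms by (simp add: R_def poly_roots_finite)
  have "(\<Prod>a\<in>R'. [:-a, 1:]) dvd q" if "R' \<subseteq> R" for R'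
  proof -
    have "finite R'" using that finR finite_subset by blast
    then show ?thesis using that
    proof (induction R' rule: finite_induct)
      case (insert a F)
      then obtain s where s: "q = (\<Prod>a\<in>F. [:-a, 1:]) * s" by (auto elim: dvdE)
      have "poly s a = 0"
        using insert.hyps insert.prems s by (auto simp: R_def poly_prod)
      then obtain t where "s = [:-a, 1:] * t"
        by (auto simp: poly_eq_0_iff_dvd elim: dvdE)
      then have "q = (\<Prod>a\<in>insert a F. [:-a, 1:]) * t"
        using s insert.hyps by (simp only: prod.insert not_False_eq_True ac_simps)
      then show ?case by (metis dvd_triv_left)
    qed simp
  qed
  then obtain s where s: "q = (\<Prod>a\<in>R. [:-a, 1:]) * s" by (auto elim: dvdE)
  show thesis
  proof (cases "degree s = 0")
    case True
    then obtain c where "s = [:c:]" by (metis degree_eq_zeroE)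
    then show thesis
      using simple_real_roots[of c R] s finR assms by auto
  next
    case False
    define S where "S = map_poly complex_of_real s"
    have "degree S \<noteq> 0" using False by (simp add: S_def degree_map_poly)
    then obtain z where z: "poly S z = 0"
      using fundamental_theorem_of_algebra[of S] constant_degree[of S] by auto
    show thesis
    proof (cases "Im z = 0")
      case True
      define a where "a = Re z"
      have "z = of_real a" using True by (simp add: a_def complex_eq_iff)
      then have "complex_of_real (poly s a) = 0"
        using z poly_map_of_real_of_real[of s a] by (simp add: S_def)
      then have sa: "poly s a = 0" by simp
      then have "poly q a = 0" by (simp add: s)
      then have "a \<in> R" by (simp add: R_def)
      then have R: "(\<Prod>a\<in>R. [:-a, 1:]) = [:-a, 1:] * (\<Prod>a\<in>R - {a}. [:-a, 1:])"
        by (rule prod.remove[OF finR])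
      obtain t where "s = [:-a, 1:] * t"
        using sa by (auto simp: poly_eq_0_iff_dvd elim: dvdE)
      then have "q = [:-a, 1:] * [:-a, 1:] * ((\<Prod>a\<in>R - {a}. [:-a, 1:]) * t)"
        unfolding s R by (simp only: ac_simps)
      then show thesis by (rule double_root)
    next
      case False
      define a where "a = Re z"
      define b where "b = Im z"
      define k where "k = [:-a, 1:] * [:-a, 1:] + [:b:] * [:b:]"
      have k: "k = [:a\<^sup>2 + b\<^sup>2, -2 * a, 1:]" by (simp add: k_def power2_eq_square)
      have "degree (s mod k) < 2"
        using degree_mod_less'[of k s] k by fastforce
      then have "s mod k = [:coeff (s mod k) 0, coeff (s mod k) 1:]"
        by (intro poly_eqI) (auto simp: coeff_pCons coeff_eq_0 split: nat.split)
      then obtain u v where uv: "s mod k = [:u, v:]" by metis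
      \<comment> \<open>Modulo the real quadratic with root \<open>z\<close>, a linear remainder \<open>u + v x\<close> is left; it vanishes at the
        non-real point \<open>z\<close>, so \<open>u\<close> and \<open>v\<close> are zero.\<close>
      have "poly S z = poly (map_poly of_real k) z * poly (map_poly of_real (s div k)) z
          + poly (map_poly of_real [:u, v:]) z"
        unfolding S_def poly_map_of_real_mult[symmetric] poly_map_of_real_add[symmetric] uv[symmetric]
        by simp
      moreover have "poly (map_poly complex_of_real k) z = 0"
        by (simp add: k map_poly_pCons a_def b_def complex_eq_iff power2_eq_square algebra_simps)
      ultimately have "of_real u + z * of_real v = 0"
        using z by (simp add: map_poly_pCons)
      then have "u = 0 \<and> v = 0"
        using False by (auto simp: complex_eq_iff)
      then have "k dvd s" using uv by (simp add: dvd_eq_mod_eq_0)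
      then obtain t where "s = k * t" by (auto elim: dvdE)
      then have "q = k * ((\<Prod>a\<in>R. [:-a, 1:]) * t)"
        using s by (simp only: ac_simps)
      then show thesis
        using quadratic_factor[of b a] False unfolding k_def b_def by blast
    qed
  qed
qed

text \<open>
  Descent on the degree. For \<open>q = (x - a)\<^sup>2 r\<close> the square of \<open>(x - a) r\<close> is \<open>r q\<close>, and for
  \<open>q = ((x - a)\<^sup>2 + b\<^sup>2) r\<close> the squares of \<open>(x - a) r\<close> and \<open>b r\<close> add up to \<open>r q\<close>. Since
  \<open>L (r q) = 0\<close> and \<open>L\<close> is nonnegative on squares, each of these squares is null, and
  \<open>(x - a) r\<close> or \<open>r\<close> is a characteristic polynomial of smaller degree.
\<close>

lemma annihilator_with_simple_real_roots:
  assumes psd: "moment_psd \<beta>" and "q \<noteq> 0" "shift_by l q \<beta> = 0"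
  shows "\<exists>R. finite R \<and> shift_by l (\<Prod>a\<in>R. [:-a, 1:]) \<beta> = 0"
  using assms(2,3)
proof (induction "degree q" arbitrary: q rule: less_induct)
  case less
  from less.prems(1) show ?case
  proof (cases rule: real_poly_cases)
    case (simple_real_roots c R)
    then have "c *\<^sub>R shift_by l (\<Prod>a\<in>R. [:-a, 1:]) \<beta> = 0"
      using less.prems(2) by (simp add: shift_by_smult)
    then show ?thesis using simple_real_roots by auto
  next
    case (double_root a r)
    define f where "f = [:-a, 1:] * r"
    have "shift_by l (f * f) \<beta> = shift_by l (r * q) \<beta>"
      unfolding f_def double_root by (simp only: ac_simps)
    then have "shift_by l f \<beta> = 0"
      using less.prems(2) by (intro shift_by_zero_if_square_zero[OF psd]) (simp add: shift_by_mult)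
    moreover have "f \<noteq> 0" "degree f < degree q"
    proof -
      have q: "q = [:-a, 1:] * f" by (simp only: double_root f_def ac_simps)
      then show "f \<noteq> 0" using less.prems(1) by auto
      then show "degree f < degree q"
        unfolding q by (subst degree_mult_eq) auto
    qed
    ultimately show ?thesis using less.hyps by blast
  next
    case (quadratic_factor a b r)
    define f where "f = [:-a, 1:] * r"
    have "f * f + smult (b\<^sup>2) (r * r) = r * q"
    proof -
      have "[:b:] * [:b:] * (r * r) = smult (b\<^sup>2) (r * r)"
        by (simp add: power2_eq_square)
      then show ?thesis
        unfolding f_def quadratic_factor(2) by (simp only: distrib_right distrib_left ac_simps)
    qed
    then have "shift_by l (f * f) \<beta> 0 + b\<^sup>2 * shift_by l (r * r) \<beta> 0 = shift_by l (r * q) \<beta> 0"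
      by (metis shift_by_add shift_by_smult scaleR_fun_def plus_fun_apply real_scaleR_def)
    also have "\<dots> = 0" using less.prems(2) by (simp add: shift_by_mult)
    finally have "b\<^sup>2 * shift_by l (r * r) \<beta> 0 = 0"
      using shift_by_square_nonneg[OF psd, of l f] shift_by_square_nonneg[OF psd, of l r]
      by (metis add_nonneg_eq_0_iff zero_le_power2 mult_nonneg_nonneg)
    then have "shift_by l r \<beta> = 0"
      using quadratic_factor(1) by (intro shift_by_zero_if_square_zero[OF psd]) simp
    moreover have "r \<noteq> 0" using less.prems(1) quadratic_factor(2) by auto
    moreover have "degree r < degree q"
    proof -
      have k: "[:-a, 1:] * [:-a, 1:] + [:b:] * [:b:] = [:a\<^sup>2 + b\<^sup>2, -2 * a, 1:]"
        by (simp add: power2_eq_square)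
      show ?thesis
        unfolding quadratic_factor(2) k using \<open>r \<noteq> 0\<close> by (subst degree_mult_eq) auto
    qed
    ultimately show ?thesis using less.hyps by blast
  qed
qed

section \<open>Simultaneous eigenvectors of the shifts\<close>

lemma shift_by_1 [simp]: "shift_by l 1 \<beta> = \<beta>"
  using shift_by_const[of l 1 \<beta>] by (simp add: one_pCons)

text \<open>
  An operator annihilated by a product of distinct linear factors is diagonalisable. The eigenvectors
  are kept in the form \<open>h (S\<^sub>l) \<gamma>\<close>, so that every relation \<open>q (S\<^sub>m) \<gamma> = 0\<close> is inherited by them
  when the other directions are treated.
\<close>

lemma in_span_shift_eigenvectors:
  assumes "finite R" "shift_by l (\<Prod>a\<in>R. [:-a, 1:]) \<gamma> = 0"
  shows "\<gamma> \<in> span {shift_by l h \<gamma> | h a. a \<in> R \<and> shift_by l [:-a, 1:] (shift_by l h \<gamma>) = 0}"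
  using assms
proof (induction R arbitrary: \<gamma> rule: finite_induct)
  case empty
  then have "\<gamma> = 0" by (simp only: prod.empty shift_by_1)
  then show ?case by (simp only: span_zero)
next
  case (insert b R)
  let ?E = "{shift_by l h \<gamma> | h a. a \<in> insert b R \<and> shift_by l [:-a, 1:] (shift_by l h \<gamma>) = 0}"
  define Q where "Q = (\<Prod>a\<in>R. [:-a, 1:])"
  define c where "c = poly Q b"
  have c: "c \<noteq> 0"
    using insert.hyps by (auto simp: c_def Q_def poly_prod)
  have kill: "shift_by l ([:-b, 1:] * Q) \<gamma> = 0"
    using insert.prems insert.hyps unfolding Q_def by (simp only: prod.insert not_False_eq_True)
  \<comment> \<open>Partial fractions: \<open>1 = Q / Q(b) + (x - b) h\<close>. The first part of \<open>\<gamma>\<close> is an eigenvector for \<open>b\<close>,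
    the second is annihilated by \<open>Q\<close>.\<close>
  have "poly (1 - smult (1 / c) Q) b = 0"
    using c by (simp add: c_def)
  then obtain h where h: "1 - smult (1 / c) Q = [:-b, 1:] * h"
    unfolding poly_eq_0_iff_dvd by (elim dvdE)
  define \<gamma>1 where "\<gamma>1 = shift_by l (smult (1 / c) Q) \<gamma>"
  define \<gamma>2 where "\<gamma>2 = shift_by l ([:-b, 1:] * h) \<gamma>"
  have "\<gamma> = shift_by l (smult (1 / c) Q + [:-b, 1:] * h) \<gamma>"
    unfolding h[symmetric] by simp
  then have split: "\<gamma> = \<gamma>1 + \<gamma>2"
    by (simp only: shift_by_add \<gamma>1_def \<gamma>2_def)
  have "shift_by l [:-b, 1:] \<gamma>1 = shift_by l (smult (1 / c) ([:-b, 1:] * Q)) \<gamma>"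
    unfolding \<gamma>1_def shift_by_mult[symmetric] by (simp only: mult_smult_right)
  then have "shift_by l [:-b, 1:] \<gamma>1 = 0"
    by (simp only: shift_by_smult kill scaleR_zero_right)
  then have 1: "\<gamma>1 \<in> span ?E"
    unfolding \<gamma>1_def by (intro span_base) blast
  have "shift_by l Q \<gamma>2 = shift_by l (h * ([:-b, 1:] * Q)) \<gamma>"
    unfolding \<gamma>2_def shift_by_mult[symmetric] by (simp only: ac_simps)
  then have "shift_by l Q \<gamma>2 = 0"
    using kill by (simp only: shift_by_mult[of _ h] shift_by_0_right)
  then have "\<gamma>2 \<in> span {shift_by l h \<gamma>2 | h a. a \<in> R \<and> shift_by l [:-a, 1:] (shift_by l h \<gamma>2) = 0}"
    unfolding Q_def by (rule insert.IH)
  moreover have "{shift_by l h \<gamma>2 | h a. a \<in> R \<and> shift_by l [:-a, 1:] (shift_by l h \<gamma>2) = 0} \<subseteq> ?E"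
    unfolding \<gamma>2_def by (auto simp only: shift_by_mult[symmetric])
  ultimately have "\<gamma>2 \<in> span ?E"
    using span_mono by blast
  with 1 show ?case
    by (subst split) (rule span_add)
qed

lemma multi_index_induct [case_names zero shift]:
  fixes i :: "nat ^ 'd"
  assumes zero: "P 0" and shift: "\<And>l i. P i \<Longrightarrow> P (axis l 1 + i)"
  shows "P i"
proof (induction "total_degree i" arbitrary: i rule: less_induct)
  case less
  show ?case
  proof (cases "i = 0")
    case False
    then obtain l where l: "i $ l > 0" by (auto simp: vec_eq_iff)
    define j where "j = i - axis l 1"
    have i: "i = axis l 1 + j"
      using l by (auto simp: j_def vec_eq_iff axis_def)
    have "total_degree i = total_degree j + 1"
      unfolding i by (simp add: total_degree_def sum.distrib axis_def)
    then show ?thesis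
      using less shift i by simp
  qed (simp add: zero)
qed

lemma monomial_at_add: "monomial_at (i + j) x = monomial_at i x * monomial_at j x"
  by (simp add: monomial_at_def power_add prod.distrib)

lemma monomial_at_0 [simp]: "monomial_at 0 x = 1"
  by (simp add: monomial_at_def)

lemma monomial_at_axis: "monomial_at (axis l k) x = (x $ l) ^ k"
proof -
  have "monomial_at (axis l k) x = (\<Prod>m\<in>UNIV. if m = l then (x $ l) ^ k else 1)"
    unfolding monomial_at_def by (rule prod.cong) (auto simp: axis_def)
  then show ?thesis by simp
qed

lemma shift_eigenvector_eq_monomials:
  assumes "\<And>l. shift_by l [:- (g $ l), 1:] \<gamma> = 0"
  shows "\<gamma> i = \<gamma> 0 * monomial_at i g"
proof (induction i rule: multi_index_induct)
  case (shift l i)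
  have "\<gamma> (axis l 1 + i) = g $ l * \<gamma> i"
    using fun_cong[OF assms[of l], of i] by (simp add: shift_by_pCons)
  then show ?case
    using shift by (simp add: monomial_at_add monomial_at_axis)
qed simp

text \<open>
  Simultaneous diagonalisation: one direction after the other is made an eigendirection, which ends
  with joint eigenvectors whose eigenvalues form a point of the grid.
\<close>

lemma in_span_monomials_on_grid:
  fixes \<beta> :: "nat ^ 'd \<Rightarrow> real"
  assumes fin: "\<And>l. finite (R l)" and kill: "\<And>l. shift_by l (\<Prod>a\<in>R l. [:-a, 1:]) \<beta> = 0"
  shows "\<beta> \<in> span ((\<lambda>g i. monomial_at i g) ` {g. \<forall>l. g $ l \<in> R l})"
proof -
  \<comment> \<open>\<open>N F\<close> consists of the annihilated multisequences that are already eigenvectors in the directions of \<open>F\<close>.\<close>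
  define N where "N = (\<lambda>F. {\<gamma>. (\<forall>l. shift_by l (\<Prod>a\<in>R l. [:-a, 1:]) \<gamma> = 0) \<and>
    (\<forall>l\<in>F. \<exists>a\<in>R l. shift_by l [:-a, 1:] \<gamma> = 0)})"
  have step: "N F \<subseteq> span (N (insert l F))" for l F
  proof
    fix \<gamma> assume \<gamma>: "\<gamma> \<in> N F"
    have "shift_by l h \<gamma> \<in> N (insert l F)"
      if "a \<in> R l" "shift_by l [:-a, 1:] (shift_by l h \<gamma>) = 0" for h a
    proof -
      have pres: "shift_by m q (shift_by l h \<gamma>) = 0" if "shift_by m q \<gamma> = 0" for m q
        by (simp only: shift_by_commute[of m q l h] that shift_by_0_right)
      show ?thesis
        using \<gamma> that pres unfolding N_def by blast
    qed
    then have "{shift_by l h \<gamma> | h a. a \<in> R l \<and> shift_by l [:-a, 1:] (shift_by l h \<gamma>) = 0}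
        \<subseteq> N (insert l F)"
      by blast
    moreover have "\<gamma> \<in> span {shift_by l h \<gamma> | h a. a \<in> R l \<and> shift_by l [:-a, 1:] (shift_by l h \<gamma>) = 0}"
      using \<gamma> by (intro in_span_shift_eigenvectors fin) (auto simp: N_def)
    ultimately show "\<gamma> \<in> span (N (insert l F))"
      using span_mono by blast
  qed
  have "\<beta> \<in> span (N F)" if "finite F" for F
    using that
  proof (induction F rule: finite_induct)
    case empty
    then show ?case using kill by (intro span_base) (simp add: N_def)
  next
    case (insert l F)
    then show ?case
      using span_minimal[OF step subspace_span] by blast
  qed
  then have "\<beta> \<in> span (N UNIV)" by simp
  moreover have "N UNIV \<subseteq> span ((\<lambda>g i. monomial_at i g) ` {g. \<forall>l. g $ l \<in> R l})"
  proof
    fix \<gamma> assume "\<gamma> \<in> N UNIV"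
    then have "\<forall>l. \<exists>a\<in>R l. shift_by l [:-a, 1:] \<gamma> = 0" by (simp add: N_def)
    then obtain a where a: "\<And>l. a l \<in> R l" "\<And>l. shift_by l [:- a l, 1:] \<gamma> = 0" by metis
    define g where "g = vec_lambda a"
    have "\<gamma> = \<gamma> 0 *\<^sub>R (\<lambda>i. monomial_at i g)"
      unfolding fun_eq_iff scaleR_fun_def real_scaleR_def
      using a by (intro allI shift_eigenvector_eq_monomials) (simp add: g_def)
    moreover have "\<gamma> 0 *\<^sub>R (\<lambda>i. monomial_at i g) \<in> span ((\<lambda>g i. monomial_at i g) ` {g. \<forall>l. g $ l \<in> R l})"
      using a by (intro span_scale span_base imageI) (simp add: g_def)
    ultimately show "\<gamma> \<in> span ((\<lambda>g i. monomial_at i g) ` {g. \<forall>l. g $ l \<in> R l})"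
      by (simp only:)
  qed
  ultimately show ?thesis
    using span_minimal[OF _ subspace_span] by blast
qed

section \<open>Polynomial functions on Euclidean space\<close>

definition polynomial_functions :: "(real ^ 'd \<Rightarrow> real) set"
  where "polynomial_functions = span (range monomial_at)"

lemma polynomial_functions_induct [consumes 1, case_names zero step]:
  assumes "f \<in> polynomial_functions"
    and "P (\<lambda>x. 0)"
    and "\<And>c i f. f \<in> polynomial_functions \<Longrightarrow> P f \<Longrightarrow> P (\<lambda>x. c * monomial_at i x + f x)"
  shows "P f"
proof -
  have "f \<in> span (range monomial_at)" using assms(1) by (simp add: polynomial_functions_def)
  then have "f \<in> polynomial_functions \<and> P f"
  proof (induction rule: span_induct_alt)
    case base
    show ?case
      using assms(2) span_zero[of "range monomial_at"]
      unfolding polynomial_functions_def zero_fun_def by simp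
  next
    case (step c m f)
    then obtain i where "m = monomial_at i" by blast
    moreover have "c *\<^sub>R m + f \<in> polynomial_functions"
      using step span_add[OF span_scale[OF span_base[OF step(1)]]]
      unfolding polynomial_functions_def by blast
    ultimately show ?case
      using step assms(3)[of f c i] by (simp add: scaleR_fun_def plus_fun_def)
  qed
  then show ?thesis by simp
qed

lemma polynomial_functions_scale:
  "f \<in> polynomial_functions \<Longrightarrow> (\<lambda>x. c * f x) \<in> polynomial_functions"
  using span_scale[of f "range monomial_at" c] by (simp add: polynomial_functions_def scaleR_fun_def)

lemma polynomial_functions_add:
  "f \<in> polynomial_functions \<Longrightarrow> g \<in> polynomial_functions \<Longrightarrow> (\<lambda>x. f x + g x) \<in> polynomial_functions"
  using span_add[of f "range monomial_at" g] by (simp add: polynomial_functions_def plus_fun_def)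

lemma polynomial_functions_monomial: "monomial_at i \<in> polynomial_functions"
  by (simp add: polynomial_functions_def span_base)

lemma polynomial_functions_const: "(\<lambda>x. c) \<in> polynomial_functions"
  using polynomial_functions_scale[OF polynomial_functions_monomial[of 0], of c] by simp

lemma polynomial_functions_coordinate: "(\<lambda>x. x $ l) \<in> polynomial_functions"
  using polynomial_functions_monomial[of "axis l 1"] by (simp add: monomial_at_axis[abs_def])

lemma polynomial_functions_mult:
  assumes f: "f \<in> polynomial_functions" and g: "g \<in> polynomial_functions"
  shows "(\<lambda>x. f x * g x) \<in> polynomial_functions"
proof -
  have mono: "(\<lambda>x. monomial_at i x * g x) \<in> polynomial_functions" for i
    using g
  proof (induction rule: polynomial_functions_induct)
    case zero
    then show ?case by (simp add: polynomial_functions_const)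
  next
    case (step c j f)
    then show ?case
      using polynomial_functions_add[OF polynomial_functions_scale[OF
            polynomial_functions_monomial[of "i + j"], of c]]
      by (simp add: monomial_at_add algebra_simps)
  qed
  show ?thesis
    using f
  proof (induction rule: polynomial_functions_induct)
    case zero
    then show ?case by (simp add: polynomial_functions_const)
  next
    case (step c i f)
    then show ?case
      using polynomial_functions_add[OF polynomial_functions_scale[OF mono[of i], of c]]
      by (simp add: algebra_simps)
  qed
qed

lemma polynomial_functions_sum:
  assumes "\<And>a. a \<in> A \<Longrightarrow> f a \<in> polynomial_functions"
  shows "(\<lambda>x. \<Sum>a\<in>A. f a x) \<in> polynomial_functions"
  using assms
  by (induction A rule: infinite_finite_induct)
    (auto intro: polynomial_functions_const polynomial_functions_add)

lemma polynomial_functions_prod: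
  assumes "\<And>a. a \<in> A \<Longrightarrow> f a \<in> polynomial_functions"
  shows "(\<lambda>x. \<Prod>a\<in>A. f a x) \<in> polynomial_functions"
  using assms
  by (induction A rule: infinite_finite_induct)
    (auto intro: polynomial_functions_const polynomial_functions_mult)

text \<open>
  Squared distances to the points of \<open>S\<close> give a polynomial that is nonnegative everywhere and zero
  exactly on \<open>S\<close>. It localises measures and also yields the interpolating polynomials.
\<close>

definition vanishing_polynomial :: "(real ^ 'd) set \<Rightarrow> real ^ 'd \<Rightarrow> real"
  where "vanishing_polynomial S x = (\<Prod>h\<in>S. (norm (x - h))\<^sup>2)"

lemma vanishing_polynomial_polynomial: "vanishing_polynomial S \<in> polynomial_functions"
proof -
  have "(\<lambda>x. (norm (x - h))\<^sup>2) \<in> polynomial_functions" for h :: "real ^ 'd"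
  proof -
    have "(\<lambda>x. (norm (x - h))\<^sup>2) = (\<lambda>x. \<Sum>l\<in>UNIV. (x $ l + - h $ l) * (x $ l + - h $ l))"
      by (simp add: power2_norm_eq_inner inner_vec_def fun_eq_iff)
    then show ?thesis
      by (simp only:) (intro polynomial_functions_sum polynomial_functions_mult
          polynomial_functions_add polynomial_functions_coordinate polynomial_functions_const)
  qed
  then show ?thesis
    unfolding vanishing_polynomial_def[abs_def] by (intro polynomial_functions_prod)
qed

lemma vanishing_polynomial_nonneg: "0 \<le> vanishing_polynomial S x"
  by (simp add: vanishing_polynomial_def prod_nonneg)

lemma vanishing_polynomial_eq_0_iff:
  "finite S \<Longrightarrow> vanishing_polynomial S x = 0 \<longleftrightarrow> x \<in> S"
  by (auto simp: vanishing_polynomial_def)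

lemma polynomial_separating_point:
  assumes "finite S"
  obtains f where "f \<in> polynomial_functions" "\<And>h. h \<in> S \<Longrightarrow> f h = (if h = g then 1 else 0)"
proof -
  let ?V = "vanishing_polynomial (S - {g})"
  have "(\<lambda>x. 1 / ?V g * ?V x) \<in> polynomial_functions"
    by (intro polynomial_functions_scale vanishing_polynomial_polynomial)
  moreover have "1 / ?V g * ?V h = (if h = g then 1 else 0)" if "h \<in> S" for h
    using that assms vanishing_polynomial_eq_0_iff[of "S - {g}"] by auto
  ultimately show thesis using that by blast
qed

section \<open>Multisequences given by finitely many weighted points\<close>

text \<open>
  By linearity, weights that are orthogonal to all monomials can be tested against interpolating
  polynomials, which pick out a single weight.
\<close>

lemma null_weights_on_polynomials:
  assumes "f \<in> polynomial_functions" and "\<And>i. (\<Sum>g\<in>S. u g * monomial_at i g) = 0"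
  shows "(\<Sum>g\<in>S. u g * f g) = 0"
  using assms(1)
proof (induction rule: polynomial_functions_induct)
  case (step c i f)
  have "(\<Sum>g\<in>S. u g * (c * monomial_at i g + f g))
      = c * (\<Sum>g\<in>S. u g * monomial_at i g) + (\<Sum>g\<in>S. u g * f g)"
    by (simp add: sum.distrib sum_distrib_left algebra_simps)
  then show ?case using step assms(2) by simp
qed simp

lemma monomial_weights_zero:
  assumes "finite S" "\<And>i. (\<Sum>g\<in>S. u g * monomial_at i g) = 0" "h \<in> S"
  shows "u h = 0"
proof -
  obtain f where f: "f \<in> polynomial_functions" "\<And>g. g \<in> S \<Longrightarrow> f g = (if g = h then 1 else 0)"
    using polynomial_separating_point[OF assms(1)] by metis
  have "u h = (\<Sum>g\<in>S. u g * f g)"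
    using assms(1,3) by (simp add: f(2) if_distrib cong: if_cong)
  then show ?thesis using null_weights_on_polynomials[OF f(1) assms(2)] by simp
qed

lemma sum_fun_apply: "(\<Sum>a\<in>A. f a) x = (\<Sum>a\<in>A. f a x)" for f :: "'a \<Rightarrow> 'b \<Rightarrow> real"
  by (induction A rule: infinite_finite_induct) auto

lemma inj_on_independent_point_evaluations:
  assumes "finite S"
  shows "inj_on (\<lambda>g i. monomial_at i g) S" "independent ((\<lambda>g i. monomial_at i g) ` S)"
proof -
  let ?v = "\<lambda>g i. monomial_at i g"
  show inj: "inj_on ?v S"
  proof (rule inj_onI, rule ccontr)
    fix g h assume gh: "g \<in> S" "h \<in> S" "?v g = ?v h" "g \<noteq> h"
    have "(\<Sum>k\<in>{g, h}. (if k = g then 1 else - 1) * monomial_at i k) = 0" for i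
      using gh by (simp add: fun_cong[OF gh(3), of i])
    from monomial_weights_zero[OF _ this, of g] show False by simp
  qed
  show "independent (?v ` S)"
    unfolding independent_explicit_finite_subsets
  proof (intro allI impI)
    fix A u
    assume A: "A \<subseteq> ?v ` S" "finite A" "(\<Sum>v\<in>A. u v *\<^sub>R v) = 0"
    then obtain T where T: "T \<subseteq> S" "A = ?v ` T" by (meson subset_imageE)
    have finT: "finite T" and injT: "inj_on ?v T"
      using T assms inj finite_subset inj_on_subset by blast+
    have "(\<Sum>g\<in>T. u (?v g) * monomial_at i g) = 0" for i
    proof -
      have "(\<Sum>g\<in>T. u (?v g) * monomial_at i g) = (\<Sum>v\<in>A. u v *\<^sub>R v) i"
        unfolding T(2) by (simp add: sum.reindex[OF injT] sum_fun_apply scaleR_fun_def)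
      then show ?thesis using A(3) by simp
    qed
    from monomial_weights_zero[OF finT this]
    show "\<forall>v\<in>A. u v = 0" unfolding T(2) by blast
  qed
qed

text \<open>
  The sum is \<open>L (f\<^sup>2)\<close>: expanding \<open>f\<close> in monomials turns it into the quadratic form of the moment
  matrix.
\<close>

lemma moment_psd_polynomial_square:
  assumes psd: "moment_psd \<beta>" and \<beta>: "\<And>i. \<beta> i = (\<Sum>g\<in>S. w g * monomial_at i g)"
    and f: "f \<in> polynomial_functions"
  shows "0 \<le> (\<Sum>g\<in>S. w g * (f g)\<^sup>2)"
proof -
  obtain T r where T: "finite T" "T \<subseteq> range monomial_at" "f = (\<Sum>m\<in>T. r m *\<^sub>R m)"
    using f unfolding polynomial_functions_def span_explicit by auto
  define c where "c = inv (monomial_at :: nat ^ 'a \<Rightarrow> _)"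
  have c: "monomial_at (c m) = m" if "m \<in> T" for m
    using that T(2) unfolding c_def by (intro f_inv_into_f) auto
  have fx: "f x = (\<Sum>m\<in>T. r m * monomial_at (c m) x)" for x
    unfolding T(3) sum_fun_apply using c by (intro sum.cong) (auto simp: scaleR_fun_def)
  have "0 \<le> (\<Sum>m\<in>T. \<Sum>n\<in>T. r m * r n * \<beta> (c m + c n))"
    by (rule moment_psd_family[OF psd T(1)])
  also have "\<dots> = (\<Sum>m\<in>T. \<Sum>n\<in>T. \<Sum>g\<in>S. w g * ((r m * monomial_at (c m) g) * (r n * monomial_at (c n) g)))"
    by (simp add: \<beta> monomial_at_add sum_distrib_left ac_simps)
  also have "\<dots> = (\<Sum>g\<in>S. \<Sum>m\<in>T. \<Sum>n\<in>T. w g * ((r m * monomial_at (c m) g) * (r n * monomial_at (c n) g)))"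
    by (subst sum.swap[of _ S], intro sum.cong refl sum.swap)
  also have "\<dots> = (\<Sum>g\<in>S. w g * (f g)\<^sup>2)"
  proof (rule sum.cong[OF refl])
    fix g
    have "(f g)\<^sup>2 = (\<Sum>m\<in>T. \<Sum>n\<in>T. (r m * monomial_at (c m) g) * (r n * monomial_at (c n) g))"
      by (simp only: fx power2_eq_square sum_product)
    then show "(\<Sum>m\<in>T. \<Sum>n\<in>T. w g * ((r m * monomial_at (c m) g) * (r n * monomial_at (c n) g)))
        = w g * (f g)\<^sup>2"
      by (simp only: sum_distrib_left)
  qed
  finally show ?thesis .
qed

lemma moment_psd_weight_nonneg:
  assumes "moment_psd \<beta>" "\<And>i. \<beta> i = (\<Sum>g\<in>S. w g * monomial_at i g)" "finite S" "h \<in> S"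
  shows "0 \<le> w h"
proof -
  obtain f where f: "f \<in> polynomial_functions" "\<And>g. g \<in> S \<Longrightarrow> f g = (if g = h then 1 else 0)"
    using polynomial_separating_point[OF assms(3)] by metis
  have "(\<Sum>g\<in>S. w g * (f g)\<^sup>2) = (\<Sum>g\<in>S. if g = h then w h else 0)"
    by (rule sum.cong) (auto simp: f(2))
  then have "(\<Sum>g\<in>S. w g * (f g)\<^sup>2) = w h"
    using assms(3,4) by simp
  then show ?thesis using moment_psd_polynomial_square[OF assms(1,2) f(1)] by simp
qed

text \<open>
  The vectors \<open>v\<^sub>g = (g\<^sup>i)\<^sub>i\<close> with \<open>g \<in> S\<close> form a basis of the column space. The column with index
  \<open>j\<close> is \<open>\<Sum>g\<in>S. w g * g\<^sup>j * v\<^sub>g\<close>. Conversely, the column space contains \<open>\<Sum>g\<in>S. w g * f g * v\<^sub>g\<close>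
  for every polynomial \<open>f\<close>, and interpolation isolates one \<open>v\<^sub>g\<close> because \<open>w g \<noteq> 0\<close>.
\<close>

lemma matrix_rank_eq_card_points:
  assumes \<beta>: "\<And>i. \<beta> i = (\<Sum>g\<in>S. w g * monomial_at i g)" and fin: "finite S"
    and w: "\<And>g. g \<in> S \<Longrightarrow> w g \<noteq> 0"
  shows "matrix_rank (moment_matrix \<beta>) = card S"
proof -
  let ?v = "\<lambda>g i. monomial_at i g"
  let ?C = "columns_of (moment_matrix \<beta>)"
  have col: "(\<lambda>i. moment_matrix \<beta> i j) = (\<Sum>g\<in>S. (w g * monomial_at j g) *\<^sub>R ?v g)" for j
    by (rule ext) (simp add: moment_matrix_def \<beta> sum_fun_apply scaleR_fun_def monomial_at_add ac_simps)
  have "?C \<subseteq> span (?v ` S)"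
    unfolding columns_of_def col by (intro image_subsetI span_sum span_scale span_base imageI)
  moreover have poly: "(\<Sum>g\<in>S. (w g * f g) *\<^sub>R ?v g) \<in> span ?C" if "f \<in> polynomial_functions" for f
    using that
  proof (induction rule: polynomial_functions_induct)
    case zero
    show ?case
      by (simp only: mult_zero_right scaleR_zero_left sum.neutral_const span_zero)
  next
    case (step c j f)
    have "(\<Sum>g\<in>S. (w g * (c * monomial_at j g + f g)) *\<^sub>R ?v g)
        = c *\<^sub>R (\<lambda>i. moment_matrix \<beta> i j) + (\<Sum>g\<in>S. (w g * f g) *\<^sub>R ?v g)"
      unfolding col by (simp add: scaleR_sum_right sum.distrib[symmetric] algebra_simps)
    moreover have "(\<lambda>i. moment_matrix \<beta> i j) \<in> ?C"
      by (auto simp: columns_of_def)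
    ultimately show ?case
      using span_add[OF span_scale[OF span_base] step.IH] by (simp only:)
  qed
  have "?v ` S \<subseteq> span ?C"
  proof
    fix v assume "v \<in> ?v ` S"
    then obtain h where h: "h \<in> S" "v = ?v h" by blast
    obtain f where f: "f \<in> polynomial_functions" "\<And>g. g \<in> S \<Longrightarrow> f g = (if g = h then 1 else 0)"
      using polynomial_separating_point[OF fin] by metis
    have "(\<Sum>g\<in>S. (w g * f g) *\<^sub>R ?v g) = (\<Sum>g\<in>S. if g = h then w h *\<^sub>R v else 0)"
      by (rule sum.cong) (auto simp: f(2) h(2))
    then have "w h *\<^sub>R v \<in> span ?C"
      using poly[OF f(1)] fin h(1) by simp
    then have "(1 / w h) *\<^sub>R (w h *\<^sub>R v) \<in> span ?C"
      by (rule span_scale)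
    then show "v \<in> span ?C" using w[OF h(1)] by simp
  qed
  ultimately have "span (?v ` S) = span ?C"
    by (meson span_minimal subset_antisym subspace_span)
  then have "dim ?C = card (?v ` S)"
    using inj_on_independent_point_evaluations(2)[OF fin] by (rule dim_eq_card)
  then show ?thesis
    by (simp add: matrix_rank_def card_image[OF inj_on_independent_point_evaluations(1)[OF fin]])
qed

section \<open>Representing measures\<close>

lemma psd_if_representing_measure:
  assumes rep: "representing_measure \<beta> \<mu>"
  shows "moment_psd \<beta>"
  unfolding moment_psd_def psd_on_def
proof (intro allI impI)
  fix a :: "nat ^ 'a \<Rightarrow> real"
  assume "finite {i. a i \<noteq> 0} \<and> {i. a i \<noteq> 0} \<subseteq> UNIV"
  define T where "T = {i. a i \<noteq> 0}"
  have int: "integrable \<mu> (\<lambda>x. a i * a j * monomial_at (i + j) x)" for i j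
    using rep unfolding representing_measure_def by auto
  have "0 \<le> (\<integral>x. (\<Sum>i\<in>T. a i * monomial_at i x)\<^sup>2 \<partial>\<mu>)"
    by simp
  also have "\<dots> = (\<integral>x. (\<Sum>i\<in>T. \<Sum>j\<in>T. a i * a j * monomial_at (i + j) x) \<partial>\<mu>)"
    by (simp add: power2_eq_square sum_product monomial_at_add ac_simps)
  also have "\<dots> = (\<Sum>i\<in>T. \<Sum>j\<in>T. a i * a j * \<beta> (i + j))"
    using rep int by (simp add: Bochner_Integration.integral_sum representing_measure_def)
  finally show "0 \<le> (\<Sum>i\<in>{i. a i \<noteq> 0}. \<Sum>j\<in>{j. a j \<noteq> 0}. a i * a j * moment_matrix \<beta> i j)"
    by (simp add: T_def moment_matrix_def)
qed

lemma integral_polynomial_function: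
  assumes rep: "representing_measure \<beta> \<mu>"
    and \<beta>: "\<And>i. \<beta> i = (\<Sum>g\<in>S. w g * monomial_at i g)"
    and f: "f \<in> polynomial_functions"
  shows "integrable \<mu> f" "(\<integral>x. f x \<partial>\<mu>) = (\<Sum>g\<in>S. w g * f g)"
proof -
  have "integrable \<mu> f \<and> (\<integral>x. f x \<partial>\<mu>) = (\<Sum>g\<in>S. w g * f g)"
    using f
  proof (induction rule: polynomial_functions_induct)
    case (step c i f)
    have "integrable \<mu> (monomial_at i)" "(\<integral>x. monomial_at i x \<partial>\<mu>) = (\<Sum>g\<in>S. w g * monomial_at i g)"
      using rep \<beta>[of i] by (auto simp: representing_measure_def)
    then show ?case
      using step by (simp add: sum.distrib sum_distrib_left algebra_simps)
  qed simp
  then show "integrable \<mu> f" "(\<integral>x. f x \<partial>\<mu>) = (\<Sum>g\<in>S. w g * f g)" by auto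
qed

text \<open>
  The weights determine the measure. The integral of the vanishing polynomial of \<open>S\<close> is
  \<open>\<Sum>g\<in>S. w g * 0\<close>, so almost every point lies in \<open>S\<close>. Hence the polynomial separating a point
  \<open>h\<close> of \<open>S\<close> equals the indicator of \<open>h\<close> almost everywhere, and its integral \<open>w h\<close> is the mass of \<open>h\<close>.
\<close>

lemma emeasure_representing_measure:
  assumes rep: "representing_measure \<beta> \<mu>"
    and \<beta>: "\<And>i. \<beta> i = (\<Sum>g\<in>S. w g * monomial_at i g)" and fin: "finite S"
    and A: "A \<in> sets borel"
  shows "emeasure \<mu> A = (\<Sum>x\<in>S. ennreal (w x) * indicator A x)"
proof -
  note integral = integral_polynomial_function[OF rep \<beta>]
  have sets: "sets \<mu> = sets borel" using rep by (simp add: representing_measure_def)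
  have fm: "finite_measure \<mu>"
    using integral(1)[OF polynomial_functions_const[of 1]]
    by (intro finite_measureI) (auto simp: integrable_iff_bounded)
  have singleton_sets: "{h} \<in> sets \<mu>" for h by (simp add: sets)
  let ?V = "vanishing_polynomial S"
  have "(\<integral>x. ?V x \<partial>\<mu>) = 0"
    unfolding integral(2)[OF vanishing_polynomial_polynomial]
    using fin by (intro sum.neutral) (simp add: vanishing_polynomial_eq_0_iff)
  then have "AE x in \<mu>. ?V x = 0"
    using integral_nonneg_eq_0_iff_AE[OF integral(1)[OF vanishing_polynomial_polynomial[of S]]]
    by (simp add: vanishing_polynomial_nonneg)
  then have AE: "AE x in \<mu>. x \<in> S"
    by (simp add: vanishing_polynomial_eq_0_iff[OF fin])
  have atom: "emeasure \<mu> {h} = ennreal (w h)" if h: "h \<in> S" for h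
  proof -
    obtain f where f: "f \<in> polynomial_functions" "\<And>g. g \<in> S \<Longrightarrow> f g = (if g = h then 1 else 0)"
      using polynomial_separating_point[OF fin] by metis
    have "(\<integral>x. indicator {h} x \<partial>\<mu>) = (\<integral>x. f x \<partial>\<mu>)"
    proof (rule integral_cong_AE)
      show "AE x in \<mu>. indicator {h} x = f x"
        using AE by eventually_elim (auto simp: f(2))
    qed (use singleton_sets integral(1)[OF f(1)] in auto)
    also have "\<dots> = (\<Sum>g\<in>S. if g = h then w h else 0)"
      unfolding integral(2)[OF f(1)] by (rule sum.cong) (auto simp: f(2))
    finally have "measure \<mu> {h} = w h"
      using fin h sets_eq_imp_space_eq[OF sets] by simp
    then show ?thesis
      using finite_measure.emeasure_eq_measure[OF fm] by simp
  qed
  have "emeasure \<mu> A = emeasure \<mu> (A \<inter> S)"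
  proof (rule emeasure_eq_AE)
    show "AE x in \<mu>. x \<in> A \<longleftrightarrow> x \<in> A \<inter> S"
      using AE by eventually_elim auto
  qed (use A fin in \<open>auto simp: sets finite_imp_closed intro!: sets.Int borel_closed\<close>)
  also have "\<dots> = (\<Sum>x\<in>A \<inter> S. emeasure \<mu> {x})"
    using fin singleton_sets by (intro emeasure_eq_sum_singleton) auto
  also have "\<dots> = (\<Sum>x\<in>S. ennreal (w x) * indicator A x)"
    using fin by (intro sum.mono_neutral_cong_left) (auto simp: atom split: split_indicator)
  finally show ?thesis .
qed

text \<open>
  A point measure on a finite set makes all sets measurable; pushing it forward along the identity
  gives a Borel measure.
\<close>

lemma representing_measure_exists:
  fixes \<beta> :: "nat ^ 'd \<Rightarrow> real"
  assumes \<beta>: "\<And>i. \<beta> i = (\<Sum>g\<in>S. w g * monomial_at i g)" and fin: "finite S"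
    and w: "\<And>g. g \<in> S \<Longrightarrow> 0 \<le> w g"
  shows "\<exists>\<mu>. representing_measure \<beta> \<mu>"
proof
  let ?P = "point_measure S (\<lambda>g. ennreal (w g))"
  let ?\<mu> = "distr ?P borel (\<lambda>x. x)"
  have id: "(\<lambda>x. x) \<in> measurable ?P borel"
    by (simp add: measurable_point_measure_eq1)
  have "continuous_on UNIV (monomial_at i)" for i :: "nat ^ 'd"
    unfolding monomial_at_def[abs_def] by (intro continuous_intros)
  then have meas: "monomial_at i \<in> borel_measurable borel" for i :: "nat ^ 'd"
    by (rule borel_measurable_continuous_onI)
  show "representing_measure \<beta> ?\<mu>"
    unfolding representing_measure_def
  proof (intro conjI allI)
    fix i
    show "integrable ?\<mu> (monomial_at i)"
      unfolding integrable_distr_eq[OF id meas]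
      by (rule integrable_point_measure_finite[OF fin])
    show "\<beta> i = (\<integral>x. monomial_at i x \<partial>?\<mu>)"
      unfolding integral_distr[OF id meas] \<beta>
      by (simp add: lebesgue_integral_point_measure_finite[OF fin w])
  qed simp
qed

lemma unique_atomic_representing_measure:
  assumes \<beta>: "\<And>i. \<beta> i = (\<Sum>g\<in>S. w g * monomial_at i g)" and fin: "finite S"
    and w: "\<And>g. g \<in> S \<Longrightarrow> 0 < w g"
  shows "\<exists>!\<mu>. representing_measure \<beta> \<mu>"
    and "representing_measure \<beta> \<mu> \<Longrightarrow> atomic_measure (card S) \<mu>"
proof -
  note em = emeasure_representing_measure[OF _ \<beta> fin]
  have "\<mu> = \<nu>" if "representing_measure \<beta> \<mu>" "representing_measure \<beta> \<nu>" for \<mu> \<nu>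
    using that em[OF that(1)] em[OF that(2)]
    by (intro measure_eqI) (auto simp: representing_measure_def)
  moreover have "\<exists>\<mu>. representing_measure \<beta> \<mu>"
    by (rule representing_measure_exists[OF \<beta> fin less_imp_le[OF w]])
  ultimately show "\<exists>!\<mu>. representing_measure \<beta> \<mu>" by blast
  show "atomic_measure (card S) \<mu>" if "representing_measure \<beta> \<mu>"
    unfolding atomic_measure_def
    using that em[OF that] fin w unfolding representing_measure_def by blast
qed

section \<open>Linear dependencies between columns\<close>

lemma in_span_finite_image:
  assumes "x \<in> span (f ` A)" "finite A"
  shows "\<exists>u. x = (\<Sum>a\<in>A. u a *\<^sub>R f a)"
  using assms(1)
proof (induction rule: span_induct_alt)
  case base
  show ?case by (rule exI[of _ "\<lambda>a. 0"]) simp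
next
  case (step c y x)
  then obtain u b where u: "x = (\<Sum>a\<in>A. u a *\<^sub>R f a)" "b \<in> A" "y = f b" by blast
  have "c *\<^sub>R y = (\<Sum>a\<in>A. if a = b then c *\<^sub>R f b else 0)"
    using u assms(2) by simp
  also have "\<dots> = (\<Sum>a\<in>A. (if a = b then c else 0) *\<^sub>R f a)"
    by (rule sum.cong) auto
  finally have "c *\<^sub>R y + x = (\<Sum>a\<in>A. ((if a = b then c else 0) + u a) *\<^sub>R f a)"
    by (simp only: u(1) scaleR_add_left sum.distrib)
  then show ?case
    by (intro exI[of _ "\<lambda>a. (if a = b then c else 0) + u a"])
qed

definition moment_column :: "(nat ^ 'd \<Rightarrow> real) \<Rightarrow> nat ^ 'd \<Rightarrow> nat ^ 'd \<Rightarrow> real"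
  where "moment_column \<beta> j = (\<lambda>i. \<beta> (i + j))"

lemma columns_of_moment_matrix: "columns_of (moment_matrix \<beta>) = range (moment_column \<beta>)"
  by (simp add: columns_of_def moment_matrix_def moment_column_def)

lemma finite_vec_box:
  assumes "\<And>l. finite (R l)"
  shows "finite {g :: 'a ^ 'd. \<forall>l. g $ l \<in> R l}"
proof (rule finite_subset)
  show "{g :: 'a ^ 'd. \<forall>l. g $ l \<in> R l} \<subseteq> vec_lambda ` Pi\<^sub>E UNIV R"
  proof
    fix g :: "'a ^ 'd" assume "g \<in> {g. \<forall>l. g $ l \<in> R l}"
    then have "vec_nth g \<in> Pi\<^sub>E UNIV R" by auto
    then have "vec_lambda (vec_nth g) \<in> vec_lambda ` Pi\<^sub>E UNIV R" by (rule imageI)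
    then show "g \<in> vec_lambda ` Pi\<^sub>E UNIV R" by simp
  qed
  show "finite (vec_lambda ` Pi\<^sub>E UNIV R)"
    using assms by (intro finite_imageI finite_PiE) auto
qed

text \<open>
  In the sequence of columns with indices \<open>0, \<epsilon>\<^sub>l, 2 \<epsilon>\<^sub>l, \<dots>\<close> some column depends on the preceding
  ones, because independent columns are no more numerous than a finite spanning set. The first such
  dependency has leading coefficient \<open>1\<close>.
\<close>

lemma finite_rank_imp_annihilator:
  assumes "finite_rank (moment_matrix \<beta>)"
  shows "\<exists>q. lead_coeff q = 1 \<and> shift_by l q \<beta> = 0"
proof -
  define C where "C = (\<lambda>k. moment_column \<beta> (axis l k))"
  obtain B where B: "finite B" "span B = span (range (moment_column \<beta>))"
    using assms by (auto simp: finite_rank_def columns_of_moment_matrix)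
  have "\<exists>k. C k \<in> span (C ` {..<k})"
  proof (rule ccontr)
    assume "\<not> ?thesis"
    then have new: "C k \<notin> span (C ` {..<k})" for k by blast
    have "independent (C ` {..<n}) \<and> card (C ` {..<n}) = n" for n
    proof (induction n)
      case (Suc n)
      have "C n \<notin> C ` {..<n}" by (rule contrapos_nn[OF new span_base])
      then show ?case
        using Suc independent_insertI[OF new[of n]] by (simp add: lessThan_Suc)
    qed (simp add: independent_empty)
    then have "independent (C ` {..<Suc (card B)})" "card (C ` {..<Suc (card B)}) = Suc (card B)"
      by blast+
    moreover have "C ` {..<Suc (card B)} \<subseteq> span B"
      unfolding B(2) C_def by (auto intro: span_base)
    ultimately show False
      using independent_span_bound[OF B(1)] by (metis Suc_n_not_le_n)
  qed
  then obtain k where "C k \<in> span (C ` {..<k})" ..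
  from in_span_finite_image[OF this finite_lessThan]
  obtain u where u: "C k = (\<Sum>j<k. u j *\<^sub>R C j)" ..
  define q where "q = monom 1 k - (\<Sum>j<k. monom (u j) j)"
  have coeff: "coeff q n = (if n = k then 1 else if n < k then - u n else 0)" for n
    by (auto simp: q_def coeff_sum)
  then have deg: "degree q = k"
    by (intro antisym degree_le le_degree) auto
  have "shift_by l q \<beta> i = 0" for i
  proof -
    have "\<beta> (axis l k + i) = (\<Sum>j<k. u j * \<beta> (axis l j + i))"
      using fun_cong[OF u, of i] by (simp add: C_def moment_column_def sum_fun_apply scaleR_fun_def add.commute)
    then show ?thesis
      by (simp add: shift_by_def deg lessThan_Suc_atMost[symmetric] coeff sum_negf)
  qed
  then have "shift_by l q \<beta> = 0" by (simp add: fun_eq_iff)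
  then show ?thesis using coeff deg by (metis (full_types))
qed

lemma finite_rank_imp_recursively_generated:
  assumes "finite_rank (moment_matrix \<beta>)"
  shows "recursively_generated \<beta>"
  using finite_rank_imp_annihilator[OF assms]
  unfolding recursively_generated_def characteristic_iff_shift_by monic_tuple_def by metis

section \<open>Finite rank and positivity give positive atoms\<close>

lemma psd_finite_rank_imp_positive_weights:
  assumes psd: "moment_psd \<beta>" and rank: "finite_rank (moment_matrix \<beta>)"
  shows "\<exists>S w. finite S \<and> (\<forall>g\<in>S. 0 < w g) \<and> (\<forall>i. \<beta> i = (\<Sum>g\<in>S. w g * monomial_at i g))"
proof -
  have "\<exists>R. finite R \<and> shift_by l (\<Prod>a\<in>R. [:-a, 1:]) \<beta> = 0" for l
  proof -
    obtain q where q: "lead_coeff q = 1" "shift_by l q \<beta> = 0"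
      using finite_rank_imp_annihilator[OF rank] by blast
    then have "q \<noteq> 0" by auto
    then show ?thesis using annihilator_with_simple_real_roots[OF psd _ q(2)] by blast
  qed
  then obtain R where R: "\<And>l. finite (R l)" "\<And>l. shift_by l (\<Prod>a\<in>R l. [:-a, 1:]) \<beta> = 0"
    by metis
  define G where "G = {g. \<forall>l. g $ l \<in> R l}"
  have finG: "finite G"
    unfolding G_def by (rule finite_vec_box[OF R(1)])
  obtain u where u: "\<beta> = (\<Sum>g\<in>G. u g *\<^sub>R (\<lambda>i. monomial_at i g))"
    using in_span_finite_image[OF in_span_monomials_on_grid[OF R, folded G_def] finG] ..
  define S where "S = {g \<in> G. u g \<noteq> 0}"
  have "\<beta> i = (\<Sum>g\<in>G. u g * monomial_at i g)" for i
    using fun_cong[OF u, of i] by (simp add: sum_fun_apply scaleR_fun_def)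
  also have "(\<Sum>g\<in>G. u g * monomial_at i g) = (\<Sum>g\<in>S. u g * monomial_at i g)" for i
    using finG by (intro sum.mono_neutral_right) (auto simp: S_def)
  finally have \<beta>: "\<beta> i = (\<Sum>g\<in>S. u g * monomial_at i g)" for i .
  have finS: "finite S" using finG by (simp add: S_def)
  have "0 < u g" if "g \<in> S" for g
    using moment_psd_weight_nonneg[OF psd \<beta> finS that] that by (simp add: S_def)
  then show ?thesis using \<beta> finS by blast
qed

section \<open>Positivity of the truncation gives positivity\<close>

text \<open>
  If \<open>deg p\<^sub>l \<le> j\<^sub>l\<close>, the recurrence expresses the column with index \<open>j\<close> through columns of smaller
  total degree, since \<open>p\<^sub>l\<close> is monic. If \<open>p\<^sub>l = 1\<close> for some \<open>l\<close>, the box is empty and all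
  columns are zero.
\<close>

lemma column_in_span_box:
  assumes char: "\<And>l. shift_by l (p l) \<beta> = 0" and monic: "\<And>l. lead_coeff (p l) = 1"
  shows "moment_column \<beta> j \<in> span (moment_column \<beta> ` {j. \<forall>l. j $ l < degree (p l)})"
proof (induction "total_degree j" arbitrary: j rule: less_induct)
  case less
  show ?case
  proof (cases "\<forall>l. j $ l < degree (p l)")
    case True
    then show ?thesis by (intro span_base imageI) simp
  next
    case False
    then obtain l where l: "degree (p l) \<le> j $ l" by (auto simp: not_less)
    define m where "m = degree (p l)"
    define j' where "j' = j - axis l m"
    have j: "j = axis l m + j'"
      using l by (auto simp: j'_def m_def vec_eq_iff axis_def)
    have deg: "total_degree (axis l k + j') = k + total_degree j'" for k
      by (simp add: total_degree_def sum.distrib axis_def)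
    have "moment_column \<beta> j = (\<Sum>k<m. (- coeff (p l) k) *\<^sub>R moment_column \<beta> (axis l k + j'))"
    proof
      fix i
      have "0 = shift_by l (p l) \<beta> (i + j')" by (simp add: char)
      also have "\<dots> = (\<Sum>k<m. coeff (p l) k * \<beta> (axis l k + (i + j'))) + \<beta> (axis l m + (i + j'))"
        using monic[of l] by (simp add: shift_by_def m_def lessThan_Suc_atMost[symmetric])
      finally show "moment_column \<beta> j i = (\<Sum>k<m. (- coeff (p l) k) *\<^sub>R moment_column \<beta> (axis l k + j')) i"
        by (simp add: j moment_column_def sum_fun_apply scaleR_fun_def sum_negf ac_simps)
    qed
    moreover have "moment_column \<beta> (axis l k + j') \<in> span (moment_column \<beta> ` {j. \<forall>l. j $ l < degree (p l)})"
      if "k < m" for k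
      using less[of "axis l k + j'"] that deg[of m] deg[of k] j by simp
    ultimately show ?thesis
      by (simp only:) (intro span_sum span_scale, simp)
  qed
qed

text \<open>
  The moment matrix is symmetric, so a dependency of the columns is also one of the rows. Substituting
  it in both positions replaces the coefficients \<open>a\<close> by coefficients \<open>b\<close> supported on \<open>B\<close> without
  changing the value of the quadratic form.
\<close>

lemma moment_psd_if_psd_on_spanning_columns:
  assumes span: "\<And>j. moment_column \<beta> j \<in> span (moment_column \<beta> ` B)" and fin: "finite B"
    and nonneg: "\<And>b. 0 \<le> (\<Sum>i\<in>B. \<Sum>j\<in>B. b i * b j * \<beta> (i + j))"
  shows "moment_psd \<beta>"
  unfolding moment_psd_def psd_on_def
proof (intro allI impI)
  fix a :: "nat ^ 'a \<Rightarrow> real"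
  assume "finite {i. a i \<noteq> 0} \<and> {i. a i \<noteq> 0} \<subseteq> UNIV"
  define T where "T = {i. a i \<noteq> 0}"
  have dependency: "\<exists>u. moment_column \<beta> j = (\<Sum>k\<in>B. u k *\<^sub>R moment_column \<beta> k)" for j
    by (rule in_span_finite_image[OF span fin])
  obtain r where r: "\<And>j. moment_column \<beta> j = (\<Sum>k\<in>B. r j k *\<^sub>R moment_column \<beta> k)"
    using dependency by metis
  define b where "b = (\<lambda>k. \<Sum>j\<in>T. a j * r j k)"
  have replace: "(\<Sum>j\<in>T. a j * \<beta> (i + j)) = (\<Sum>k\<in>B. b k * \<beta> (i + k))" for i
  proof -
    have "a j * \<beta> (i + j) = (\<Sum>k\<in>B. a j * r j k * \<beta> (i + k))" for j
    proof -
      have "\<beta> (i + j) = (\<Sum>k\<in>B. r j k * \<beta> (i + k))"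
        using fun_cong[OF r[of j], of i]
        by (simp add: moment_column_def sum_fun_apply scaleR_fun_def)
      then have "a j * \<beta> (i + j) = a j * (\<Sum>k\<in>B. r j k * \<beta> (i + k))"
        by (rule arg_cong)
      then show ?thesis by (simp only: sum_distrib_left mult.assoc)
    qed
    then have "(\<Sum>j\<in>T. a j * \<beta> (i + j)) = (\<Sum>j\<in>T. \<Sum>k\<in>B. a j * r j k * \<beta> (i + k))"
      by (rule sum.cong[OF refl])
    also have "\<dots> = (\<Sum>k\<in>B. \<Sum>j\<in>T. a j * r j k * \<beta> (i + k))"
      by (rule sum.swap)
    finally show ?thesis by (simp add: b_def sum_distrib_right)
  qed
  have "(\<Sum>i\<in>T. \<Sum>j\<in>T. a i * a j * \<beta> (i + j)) = (\<Sum>i\<in>T. a i * (\<Sum>k\<in>B. b k * \<beta> (i + k)))"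
    by (simp only: mult.assoc sum_distrib_left[symmetric] replace)
  also have "\<dots> = (\<Sum>k\<in>B. \<Sum>i\<in>T. b k * (a i * \<beta> (k + i)))"
    by (subst sum.swap) (simp add: sum_distrib_left ac_simps)
  also have "\<dots> = (\<Sum>k\<in>B. \<Sum>m\<in>B. b k * b m * \<beta> (k + m))"
    by (simp only: mult.assoc sum_distrib_left[symmetric] replace)
  finally have "0 \<le> (\<Sum>i\<in>T. \<Sum>j\<in>T. a i * a j * \<beta> (i + j))"
    using nonneg by simp
  then show "0 \<le> (\<Sum>i\<in>{i. a i \<noteq> 0}. \<Sum>j\<in>{j. a j \<noteq> 0}. a i * a j * moment_matrix \<beta> i j)"
    by (simp add: T_def moment_matrix_def)
qed

lemma finite_rank_psd_if_truncated_psd: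
  fixes \<beta> :: "nat ^ 'd \<Rightarrow> real"
  assumes char: "characteristic \<beta> p" and monic: "monic_tuple p"
    and psd: "truncated_moment_psd \<beta> (char_order p)"
  shows "finite_rank (moment_matrix \<beta>)" "moment_psd \<beta>"
proof -
  define B where "B = {j :: nat ^ 'd. \<forall>l. j $ l < degree (p l)}"
  have span: "moment_column \<beta> j \<in> span (moment_column \<beta> ` B)" for j
    unfolding B_def using char monic
    by (intro column_in_span_box) (auto simp: characteristic_iff_shift_by monic_tuple_def)
  have fin: "finite B"
    unfolding B_def using finite_vec_box[of "\<lambda>l. {..<degree (p l)}"] by simp
  have "span (moment_column \<beta> ` B) = span (columns_of (moment_matrix \<beta>))"
  proof (rule antisym)
    show "span (moment_column \<beta> ` B) \<subseteq> span (columns_of (moment_matrix \<beta>))"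
      unfolding columns_of_moment_matrix by (intro span_mono) auto
    show "span (columns_of (moment_matrix \<beta>)) \<subseteq> span (moment_column \<beta> ` B)"
      unfolding columns_of_moment_matrix using span by (intro span_minimal) auto
  qed
  then show "finite_rank (moment_matrix \<beta>)"
    unfolding finite_rank_def using fin by (intro exI[of _ "moment_column \<beta> ` B"]) simp
  have "B \<subseteq> {i. int (total_degree i) \<le> char_order p}"
  proof
    fix j assume j: "j \<in> B"
    have "int (total_degree j) = (\<Sum>l\<in>UNIV. int (j $ l))"
      by (simp add: total_degree_def)
    also have "\<dots> \<le> char_order p"
      unfolding char_order_def using j by (intro sum_mono) (auto simp: B_def dest: spec)
    finally show "j \<in> {i. int (total_degree i) \<le> char_order p}" by simp
  qed
  then have "0 \<le> (\<Sum>i\<in>B. \<Sum>j\<in>B. b i * b j * \<beta> (i + j))" for b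
    using psd_on_sum_nonneg[OF psd[unfolded truncated_moment_psd_def] fin]
    by (simp add: moment_matrix_def)
  then show "moment_psd \<beta>"
    by (rule moment_psd_if_psd_on_spanning_columns[OF span fin])
qed

theorem theorem10:
  fixes \<beta> :: "nat ^ 'd \<Rightarrow> real"
  shows
    "(finite_rank (moment_matrix \<beta>) \<and> moment_psd \<beta> \<longleftrightarrow>
      recursively_generated \<beta> \<and>
      (\<exists>p. minimal_characteristic \<beta> p \<and> truncated_moment_psd \<beta> (char_order p))) \<and>
     (recursively_generated \<beta> \<and>
      (\<exists>p. minimal_characteristic \<beta> p \<and> truncated_moment_psd \<beta> (char_order p)) \<longleftrightarrow>
      (\<exists>!\<mu>. representing_measure \<beta> \<mu>) \<and>
      finite_rank (moment_matrix \<beta>) \<and>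
      (\<forall>\<mu>. representing_measure \<beta> \<mu> \<longrightarrow>
        atomic_measure (matrix_rank (moment_matrix \<beta>)) \<mu>))"
  (is "(?fin \<and> ?psd \<longleftrightarrow> ?rec \<and> ?trunc) \<and> (_ \<longleftrightarrow> ?unique \<and> _ \<and> ?atomic)")
proof -
  have 12: "?rec \<and> ?trunc" if fin: "?fin" and psd: "?psd"
  proof -
    have rec: ?rec using fin by (rule finite_rank_imp_recursively_generated)
    then obtain p where "minimal_characteristic \<beta> p"
      using ex1_minimal_characteristic by blast
    moreover have "truncated_moment_psd \<beta> n" for n
      using psd by (auto simp: truncated_moment_psd_def moment_psd_def psd_on_def)
    ultimately show ?thesis using rec by blast
  qed
  have 21: "?fin \<and> ?psd" if ?trunc
    using that finite_rank_psd_if_truncated_psd unfolding minimal_characteristic_def by blast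
  have 13: "?unique \<and> ?atomic" if fin: "?fin" and psd: "?psd"
  proof -
    obtain S w where S: "finite S" "\<And>g. g \<in> S \<Longrightarrow> 0 < w g"
      "\<And>i. \<beta> i = (\<Sum>g\<in>S. w g * monomial_at i g)"
      using psd_finite_rank_imp_positive_weights[OF psd fin] by blast
    have "matrix_rank (moment_matrix \<beta>) = card S"
      using matrix_rank_eq_card_points[OF S(3,1)] S(2) by force
    then show ?thesis
      using unique_atomic_representing_measure[OF S(3,1,2)] by auto
  qed
  have 31: ?psd if ?unique
    using that psd_if_representing_measure by blast
  show ?thesis
    using 12 21 13 31 by blast
qed

end
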